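(* Let $\alpha,\beta,\gamma\in[0,1]$ and $p\in(0,1)$ with $\alpha+\beta>0$ and $p\alpha+\beta-(1-p)\gamma\ge0$, and put $$t^\star=\Big(\frac{p\alpha+\beta-(1-p)\gamma}{\alpha+\beta}\Big)^{\frac1{1-p}} .$$ The solution (among continuous functions $\hat m:(0,1]\to\mathbb R$) of the integral equation $$\hat m(t)=\begin{cases}-p\,t\ln t+t+(1-p)\displaystyle\int_t^1\frac{t}{s^2}\hat m(s)\,ds, & t>t^\star,\\[2mm] -p\,t^\star\ln t^\star+t^\star+(1-p)\displaystyle\int_{t^\star}^1\frac{t^\star}{s^2}\hat m(s)\,ds, & t\le t^\star,\end{cases}\qquad t\in(0,1],$$ with $\hat m(1)=1$, is $$\hat m(t)=\begin{cases}\dfrac1{1-p}\,(t^p-pt), & t>t^\star,\\[2mm] \dfrac1{1-p}\,\big((t^\star)^p-pt^\star\big), & t\le t^\star.\end{cases}$$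
   Context: Background: $\hat m(t)$ is the limit, as the number $N$ of applicants tends to infinity, of the normalized expected completion time of the search in the best choice problem in which each candidate accepts an offer with probability $p$, when offers are made to all candidates from the threshold time $t^\star N$ on, given that the search is still going on at time $tN$. *)

theory Defs
  imports "HOL-Analysis.Analysis"
begin

text \<open>For base 0 the value is 0, since \<open>0 powr a = 0\<close>; this agrees with the usual power
  because the exponent is positive for \<open>p < 1\<close>.\<close>

definition t_star :: "real \<Rightarrow> real \<Rightarrow> real \<Rightarrow> real \<Rightarrow> real" where
  "t_star \<alpha> \<beta> \<gamma> p = ((p * \<alpha> + \<beta> - (1 - p) * \<gamma>) / (\<alpha> + \<beta>)) powr (1 / (1 - p))"

text \<open>Functions on \<open>(0,1]\<close> are represented by total functions whose values outside
  \<open>(0,1]\<close> are irrelevant: for \<open>t \<in> (0,1]\<close> the lower limit of the integral that occurs is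
  positive, so only values on \<open>(0,1]\<close> enter, and the integrand is continuous there.\<close>

definition mhat_rhs :: "real \<Rightarrow> real \<Rightarrow> (real \<Rightarrow> real) \<Rightarrow> real \<Rightarrow> real" where
  "mhat_rhs p ts m t =
    (if t > ts
     then - p * t * ln t + t + (1 - p) * integral {t..1} (\<lambda>s. t / s\<^sup>2 * m s)
     else - p * ts * ln ts + ts + (1 - p) * integral {ts..1} (\<lambda>s. ts / s\<^sup>2 * m s))"

definition mhat_solution :: "real \<Rightarrow> real \<Rightarrow> (real \<Rightarrow> real) \<Rightarrow> bool" where
  "mhat_solution p ts m \<longleftrightarrow>
    continuous_on {0<..1} m \<and> (\<forall>t\<in>{0<..1}. m t = mhat_rhs p ts m t) \<and> m 1 = 1"

end

theory Submission
  imports Defs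
begin

text \<open>
  With \<open>H t\<close> the integral of \<open>h s / s\<^sup>2\<close> over \<open>[t, 1]\<close>, the homogeneous equation
  \<open>h t = c t H t\<close> makes the derivative of \<open>t powr c * H t\<close> vanish; as \<open>H 1 = 0\<close>, it has only
  the zero solution. Hence the integral equation on \<open>[a, 1]\<close> determines \<open>m a\<close>. The branch of the
  equation for \<open>t \<le> t\<^sup>\<star>\<close> is the other branch evaluated at \<open>t\<^sup>\<star>\<close>, so taking \<open>a = max t t\<^sup>\<star>\<close>
  covers both.
\<close>

lemma homogeneous_integral_equation_zero:
  fixes h :: "real \<Rightarrow> real"
  assumes a: "0 < a" "a \<le> 1" and cont: "continuous_on {a..1} h"
    and eq: "\<And>t. t \<in> {a..1} \<Longrightarrow> h t = c * integral {t..1} (\<lambda>s. t / s\<^sup>2 * h s)"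
  shows "h a = 0"
proof -
  \<comment> \<open>Once the factor \<open>t\<close> is pulled out, the integral depends on
    \<open>t\<close> only through its lower limit, so the fundamental theorem of calculus
    applies.\<close>
  define H where "H t = integral {t..1} (\<lambda>s. h s / s\<^sup>2)" for t
  have hH: "h t = c * t * H t" if "t \<in> {a..1}" for t
    using eq[OF that] integral_mult_right[of "{t..1}" t "\<lambda>s. h s / s\<^sup>2"]
    by (simp add: H_def)
  have contq: "continuous_on {a..1} (\<lambda>s. h s / s\<^sup>2)"
    using a by (intro continuous_intros cont) auto
  have "(H has_real_derivative - (h t / t\<^sup>2)) (at t within {a..1})" if "t \<in> {a..1}" for t
    using integral_has_vector_derivative'[OF contq that]
    by (simp add: H_def[abs_def] has_real_derivative_iff_has_vector_derivative)
  \<comment> \<open>By \<open>hH\<close>, \<open>H\<close> satisfies H' = - c H / t, for which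
    \<open>t powr c\<close> is the integrating factor.\<close>
  then have "((\<lambda>t. t powr c * H t) has_real_derivative 0) (at t within {a..1})"
    if "t \<in> {a..1}" for t
    using that a hH[OF that]
    by (auto intro!: derivative_eq_intros simp: powr_diff field_simps power2_eq_square)
  then obtain k where k: "\<And>t. t \<in> {a..1} \<Longrightarrow> t powr c * H t = k"
    using has_field_derivative_zero_constant[of "{a..1}" "\<lambda>t. t powr c * H t"] by auto
  have "k = 0"
    using k[of 1] a by (simp add: H_def)
  then show ?thesis
    using k[of a] a hH[of a] by simp
qed

text \<open>The branch of the claimed solution above the threshold, taken for every
  \<open>t\<close>. It does not involve the threshold; the constant branch is its value
  there.\<close>

definition mhat_upper :: "real \<Rightarrow> real \<Rightarrow> real" where
  "mhat_upper p t = 1 / (1 - p) * (t powr p - p * t)"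

lemma continuous_on_mhat_upper: "S \<subseteq> {0<..} \<Longrightarrow> continuous_on S (mhat_upper p)"
  unfolding mhat_upper_def[abs_def] by (intro continuous_intros) auto

text \<open>The integrand is t / (1 - p) times s^(p - 2) - p / s, so it has an elementary
  antiderivative in \<open>s\<close>. Its logarithmic part contributes p t ln t, which cancels the
  logarithm outside the integral.\<close>

lemma mhat_upper_integral_equation:
  assumes t: "0 < t" "t \<le> 1" and p: "p < 1"
  shows "mhat_upper p t =
    - p * t * ln t + t + (1 - p) * integral {t..1} (\<lambda>s. t / s\<^sup>2 * mhat_upper p s)"
proof -
  define G where "G s = t / (1 - p) * (s powr (p - 1) / (p - 1) - p * ln s)" for s
  have "((\<lambda>s. t / s\<^sup>2 * mhat_upper p s) has_integral (G 1 - G t)) {t..1}"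
  proof (rule fundamental_theorem_of_calculus)
    fix s assume s: "s \<in> {t..1}"
    then have "s > 0" using t by simp
    have powr: "((\<lambda>s. s powr (p - 1)) has_real_derivative (p - 1) * s powr (p - 2))
        (at s within {t..1})"
      using has_real_derivative_powr[OF \<open>s > 0\<close>, of "p - 1"]
      by (simp add: has_field_derivative_at_within)
    have ln: "(ln has_real_derivative 1 / s) (at s within {t..1})"
      using DERIV_ln_divide[OF \<open>s > 0\<close>] by (rule has_field_derivative_at_within)
    have "(G has_real_derivative
        t / (1 - p) * ((p - 1) * s powr (p - 2) / (p - 1) - p * (1 / s))) (at s within {t..1})"
      unfolding G_def[abs_def]
      by (rule DERIV_cmult[OF DERIV_diff[OF DERIV_cdivide[OF powr] DERIV_cmult[OF ln]]])
    also have "t / (1 - p) * ((p - 1) * s powr (p - 2) / (p - 1) - p * (1 / s)) =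
        t / s\<^sup>2 * mhat_upper p s"
    proof -
      have "(p - 1) * s powr (p - 2) / (p - 1) = s powr p / s\<^sup>2"
        using \<open>s > 0\<close> p by (simp add: powr_diff)
      moreover have "p * (1 / s) = p * s / s\<^sup>2"
        using \<open>s > 0\<close> by (simp add: power2_eq_square)
      ultimately show ?thesis
        by (simp add: mhat_upper_def diff_divide_distrib right_diff_distrib mult.commute)
    qed
    finally have "(G has_real_derivative (t / s\<^sup>2 * mhat_upper p s)) (at s within {t..1})" .
    then show "(G has_vector_derivative (t / s\<^sup>2 * mhat_upper p s)) (at s within {t..1})"
      by (simp add: has_real_derivative_iff_has_vector_derivative)
  qed (use t in simp)
  then have "integral {t..1} (\<lambda>s. t / s\<^sup>2 * mhat_upper p s) = G 1 - G t"
    by (rule integral_unique)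
  moreover have "t powr (p - 1) = t powr p / t"
    using t by (simp add: powr_diff)
  ultimately show ?thesis
    using t p by (simp add: G_def mhat_upper_def divide_simps) (simp add: algebra_simps)
qed

text \<open>The inhomogeneous terms cancel in the difference of two solutions, which leaves the
  homogeneous equation with c = 1 - p. The integral looks only to the right of \<open>t\<close>, so
  the equation on \<open>{a..1}\<close> suffices, an interval on which 1 / s^2 is
  continuous.\<close>

lemma integral_equation_imp_mhat_upper:
  fixes m :: "real \<Rightarrow> real"
  assumes a: "0 < a" "a \<le> 1" and p: "p < 1" and cont: "continuous_on {a..1} m"
    and eq: "\<And>t. t \<in> {a..1} \<Longrightarrow>
      m t = - p * t * ln t + t + (1 - p) * integral {t..1} (\<lambda>s. t / s\<^sup>2 * m s)"
  shows "m a = mhat_upper p a"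
proof -
  have "m a - mhat_upper p a = 0"
  proof (rule homogeneous_integral_equation_zero[where h = "\<lambda>t. m t - mhat_upper p t"])
    show "continuous_on {a..1} (\<lambda>t. m t - mhat_upper p t)"
      using a by (intro continuous_on_diff cont continuous_on_mhat_upper) auto
    fix t assume t: "t \<in> {a..1}"
    have sub: "{t..1} \<subseteq> {a..1}" using t by auto
    have "(\<lambda>s. t / s\<^sup>2 * m s) integrable_on {t..1}"
      using a t sub
      by (intro integrable_continuous_interval continuous_intros continuous_on_subset[OF cont]) auto
    moreover have "(\<lambda>s. t / s\<^sup>2 * mhat_upper p s) integrable_on {t..1}"
      using a t
      by (intro integrable_continuous_interval continuous_intros continuous_on_mhat_upper) auto
    ultimately show "m t - mhat_upper p t =
        (1 - p) * integral {t..1} (\<lambda>s. t / s\<^sup>2 * (m s - mhat_upper p s))"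
      using eq[OF t] mhat_upper_integral_equation[of t p] a t p
      by (simp add: right_diff_distrib integral_diff)
  qed (use a in auto)
  then show ?thesis by simp
qed

lemma mhat_rhs_eq_max:
  "mhat_rhs p ts m t =
    (let u = max t ts in - p * u * ln u + u + (1 - p) * integral {u..1} (\<lambda>s. u / s\<^sup>2 * m s))"
  by (simp add: mhat_rhs_def max_def)

lemma mhat_solution_iff:
  assumes p: "p < 1" and ts: "0 \<le> ts" "ts \<le> 1"
  shows "mhat_solution p ts m \<longleftrightarrow> (\<forall>t\<in>{0<..1}. m t = mhat_upper p (max t ts))"
proof
  assume "mhat_solution p ts m"
  then have cont: "continuous_on {0<..1} m"
    and eq: "\<And>t. t \<in> {0<..1} \<Longrightarrow> m t = mhat_rhs p ts m t"
    by (auto simp: mhat_solution_def)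
  show "\<forall>t\<in>{0<..1}. m t = mhat_upper p (max t ts)"
  proof
    fix t :: real assume t: "t \<in> {0<..1}"
    define u where "u = max t ts"
    \<comment> \<open>Since \<open>t\<close> is positive, \<open>u\<close> is positive even if
      \<open>ts\<close> is 0.\<close>
    have u: "0 < u" "u \<le> 1" "ts \<le> u" using t ts by (auto simp: u_def)
    have "m u = mhat_upper p u"
    proof (rule integral_equation_imp_mhat_upper[OF u(1,2) p])
      show "continuous_on {u..1} m"
        using u by (intro continuous_on_subset[OF cont]) auto
      show "m v = - p * v * ln v + v + (1 - p) * integral {v..1} (\<lambda>s. v / s\<^sup>2 * m s)"
        if "v \<in> {u..1}" for v
        using eq[of v] that u by (simp add: mhat_rhs_eq_max max_absorb1)
    qed
    \<comment> \<open>\<open>mhat_rhs\<close> depends on \<open>t\<close> only through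
      \<open>max t ts\<close>, and this maximum is \<open>u\<close> at both points.\<close>
    moreover have "m t = m u"
      using eq[of t] eq[of u] t u by (simp add: mhat_rhs_eq_max u_def)
    ultimately show "m t = mhat_upper p (max t ts)" by (simp add: u_def)
  qed
next
  assume m: "\<forall>t\<in>{0<..1}. m t = mhat_upper p (max t ts)"
  have "continuous_on {0<..1} (\<lambda>t. mhat_upper p (max t ts))"
    by (rule continuous_on_compose2[OF continuous_on_mhat_upper[OF order_refl]])
      (auto intro!: continuous_intros)
  then have "continuous_on {0<..1} m"
    by (rule continuous_on_eq) (rule m[rule_format, symmetric])
  moreover have "m t = mhat_rhs p ts m t" if t: "t \<in> {0<..1}" for t
  proof -
    define u where "u = max t ts"
    have u: "0 < u" "u \<le> 1" "ts \<le> u" using t ts by (auto simp: u_def)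
    \<comment> \<open>Every \<open>s\<close> in the range of integration is at least
      \<open>ts\<close>, so only the upper branch of \<open>m\<close> enters.\<close>
    have "integral {u..1} (\<lambda>s. u / s\<^sup>2 * m s) = integral {u..1} (\<lambda>s. u / s\<^sup>2 * mhat_upper p s)"
      using m u by (intro integral_cong) (auto simp: max_absorb1)
    then show ?thesis
      using m t mhat_upper_integral_equation[OF u(1,2) p]
      by (simp add: mhat_rhs_eq_max Let_def flip: u_def)
  qed
  moreover have "m 1 = 1"
    using m ts p by (simp add: max_absorb1 mhat_upper_def)
  ultimately show "mhat_solution p ts m" by (simp add: mhat_solution_def)
qed

theorem lemma3p2:
  fixes \<alpha> \<beta> \<gamma> p :: real and m :: "real \<Rightarrow> real"
  assumes "\<alpha> \<in> {0..1}" and "\<beta> \<in> {0..1}" and "\<gamma> \<in> {0..1}" and "p \<in> {0<..<1}"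
    and "\<alpha> + \<beta> > 0"
    and "p * \<alpha> + \<beta> - (1 - p) * \<gamma> \<ge> 0"
  shows "mhat_solution p (t_star \<alpha> \<beta> \<gamma> p) m \<longleftrightarrow>
    (\<forall>t\<in>{0<..1}. m t =
      (if t > t_star \<alpha> \<beta> \<gamma> p
       then 1 / (1 - p) * (t powr p - p * t)
       else 1 / (1 - p) * (t_star \<alpha> \<beta> \<gamma> p powr p - p * t_star \<alpha> \<beta> \<gamma> p)))"
proof -
  \<comment> \<open>These bounds show that the base of the power in \<open>t_star\<close> is at most
    1. As the base is nonnegative and the exponent positive, the threshold lies in [0, 1].\<close>
  have "p * \<alpha> \<le> \<alpha>" "0 \<le> (1 - p) * \<gamma>"
    using assms by (auto simp: mult_left_le_one_le)
  then have "p * \<alpha> + \<beta> - (1 - p) * \<gamma> \<le> \<alpha> + \<beta>"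
    by linarith
  then have "(p * \<alpha> + \<beta> - (1 - p) * \<gamma>) / (\<alpha> + \<beta>) \<le> 1"
    using divide_le_eq_1_pos[OF assms(5)] by blast
  then have "t_star \<alpha> \<beta> \<gamma> p \<le> 1"
    unfolding t_star_def using assms by (intro powr_le1) auto
  moreover have "0 \<le> t_star \<alpha> \<beta> \<gamma> p"
    by (simp add: t_star_def)
  ultimately have "mhat_solution p (t_star \<alpha> \<beta> \<gamma> p) m \<longleftrightarrow>
      (\<forall>t\<in>{0<..1}. m t = mhat_upper p (max t (t_star \<alpha> \<beta> \<gamma> p)))"
    using assms by (intro mhat_solution_iff) auto
  moreover have "mhat_upper p (max t u) =
      (if t > u then 1 / (1 - p) * (t powr p - p * t) else 1 / (1 - p) * (u powr p - p * u))"
    for t u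
    by (simp add: mhat_upper_def max_def)
  ultimately show ?thesis
    by (simp only:)
qed

end
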